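(* Suppose that $V\subset \mathbb{R}P^d$ is a projective subspace of dimension $v$ and $X\subset\mathbb{R}P^d$ is a finite point set with $|X|=n$. Put $$ r = \left\lceil\frac{n}{(d-v)(v+1)+1}\right\rceil . $$ Then there exists a projective subspace $W\subset \mathbb{R}P^d$ of dimension $d-v-1$ such that any pair of hyperplanes $H_1\supseteq V$ and $H_2\supseteq W$ partitions $\mathbb{R}P^d$ into two parts each containing at least $r$ points of $X$. Moreover, if no $r$ points of $X$ together with $V$ are contained in a hyperplane (general position assumption), then $W$ may be chosen disjoint from $V$.
   Context: Hyperplanes are projective hyperplanes of $\mathbb{R}P^d$. Any two distinct hyperplanes $H_1$ and $H_2$ partition $\mathbb{R}P^d$ into two parts, which are always taken to be closed (i.e. the closures of the two connected components of $\mathbb{R}P^d\setminus(H_1\cup H_2)$). If $H_1=H_2$, then by convention the two parts are $H_1=H_2$ itself and the whole space $\mathbb{R}P^d$. *)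

theory Defs
  imports "HOL-Analysis.Analysis"
begin

text \<open>The projectivization of a real vector space: its points are the lines through the origin.
  In particular \<open>(real ^ 'n) rproj\<close> is real projective space of dimension \<open>CARD('n) - 1\<close>.\<close>

typedef (overloaded) ('a :: euclidean_space) rproj = "{span {x} | x :: 'a. x \<noteq> 0}"
  morphisms line_of Abs_rproj
proof -
  obtain b :: 'a where "b \<in> Basis"
    using nonempty_Basis by blast
  then show ?thesis
    using nonzero_Basis by blast
qed

definition proj_pt :: "'a :: euclidean_space \<Rightarrow> 'a rproj" where
  "proj_pt x = Abs_rproj (span {x})"

text \<open>The quotient topology with respect to \<^term>\<open>proj_pt\<close> on the complement of the origin.
  As that complement is open, openness of the preimage in the subspace and in the whole space agree;
  the condition \<open>x \<noteq> 0\<close> is essential, since \<^term>\<open>proj_pt 0\<close> is unspecified.\<close>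

instantiation rproj :: (euclidean_space) topological_space
begin

definition open_rproj :: "'a rproj set \<Rightarrow> bool" where
  "open_rproj U \<longleftrightarrow> open {x :: 'a. x \<noteq> 0 \<and> proj_pt x \<in> U}"

instance
proof
  have "{x :: 'a. x \<noteq> 0 \<and> proj_pt x \<in> UNIV} = - {0}"
    by auto
  then show "open (UNIV :: 'a rproj set)"
    unfolding open_rproj_def by (metis closed_singleton open_Compl)
next
  fix S T :: "'a rproj set"
  assume "open S" "open T"
  then have "open ({x. x \<noteq> 0 \<and> proj_pt x \<in> S} \<inter> {x. x \<noteq> 0 \<and> proj_pt x \<in> T})"
    unfolding open_rproj_def by (rule open_Int)
  moreover have "{x. x \<noteq> 0 \<and> proj_pt x \<in> S} \<inter> {x. x \<noteq> 0 \<and> proj_pt x \<in> T}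
      = {x. x \<noteq> 0 \<and> proj_pt x \<in> S \<inter> T}"
    by auto
  ultimately show "open (S \<inter> T)"
    unfolding open_rproj_def by simp
next
  fix K :: "'a rproj set set"
  assume "\<forall>S\<in>K. open S"
  then have "open (\<Union>S\<in>K. {x. x \<noteq> 0 \<and> proj_pt x \<in> S})"
    unfolding open_rproj_def by (intro open_UN)
  moreover have "(\<Union>S\<in>K. {x. x \<noteq> 0 \<and> proj_pt x \<in> S}) = {x. x \<noteq> 0 \<and> proj_pt x \<in> \<Union>K}"
    by auto
  ultimately show "open (\<Union>K)"
    unfolding open_rproj_def by simp
qed

end

text \<open>Dimensions are integers, and the empty set is the projective subspace of dimension \<open>-1\<close>.\<close>

definition proj_subspace :: "int \<Rightarrow> 'a :: euclidean_space rproj set \<Rightarrow> bool" where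
  "proj_subspace k A \<longleftrightarrow>
     (\<exists>S. subspace S \<and> int (dim S) = k + 1 \<and> A = {p. line_of p \<subseteq> S})"

text \<open>The ambient projective space has dimension \<open>DIM('a) - 1\<close>.\<close>

definition proj_hyperplane :: "'a :: euclidean_space rproj set \<Rightarrow> bool" where
  "proj_hyperplane H \<longleftrightarrow> proj_subspace (int DIM('a) - 2) H"

definition parts :: "'a :: euclidean_space rproj set \<Rightarrow> 'a rproj set \<Rightarrow> 'a rproj set set" where
  "parts H1 H2 =
     (if H1 = H2 then {H1, UNIV} else closure ` components (UNIV - (H1 \<union> H2)))"

end

theory Submission
  imports Defs
begin

text \<open>Write \<open>k = dim V + 1\<close> and \<open>m = d - dim V\<close> for the linear dimensions of \<open>V\<close> and of its orthogonal
  complement, and represent every point of \<open>X\<close> by a nonzero vector \<open>x\<close>. Hyperplanes through \<open>V\<close> and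
  through \<open>W\<close> are given by normal vectors \<open>a \<in> V\<^sup>\<bottom>\<close> and \<open>\<beta> \<in> N = W\<^sup>\<bottom>\<close>, and the two parts that they cut
  out by the sign of \<open>(\<beta> \<bullet> x) * (a \<bullet> x)\<close>. As \<open>\<beta>\<close> may be replaced by \<open>- \<beta>\<close>, a subspace \<open>N\<close> of
  dimension \<open>k\<close> is wanted such that this product is nonnegative for at least \<open>r\<close> points, for all \<open>\<beta>\<close>
  and \<open>a\<close> (\<open>balanced_subspace_exists\<close>; the translation is \<open>parts_contain_closed_wedge\<close>).

  If \<open>W\<close> is a complement of \<open>V\<close>, it is the graph of a linear map \<open>A : V\<^sup>\<bottom> \<rightarrow> V\<close>. Such maps
  form a space of dimension \<open>k * m\<close>, which is where the denominator \<open>k * m + 1\<close> comes from. Each point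
  contributes the convex function \<open>A \<mapsto> |A x - x|\<^sup>2 / 2\<close>, and the product above is, up to sign, the
  derivative of this function at \<open>A\<close> in the rank one direction \<open>b a\<^sup>T\<close>, where \<open>\<beta> = b - A\<^sup>T b\<close>. So it
  suffices to find an \<open>A\<close> at which every direction has nonpositive derivative for at least
  \<open>r\<close> of the functions, i.e. at which the origin is a centerpoint of the gradients. This
  follows from Brouwer's fixed point theorem together with Caratheodory's theorem
  (\<open>deep_zero_exists\<close>).

  Brouwer's theorem needs the fields to point outward on a large sphere, which is achieved by a
  perturbation of size \<open>\<epsilon>\<close>; then \<open>\<epsilon>\<close> tends to \<open>0\<close>, using that limits of \<open>k\<close>-dimensional subspaces exist
  (\<open>subspaces_subconverge\<close>). In the limit \<open>W\<close> may meet \<open>V\<close>. But then \<open>V\<close> and \<open>W\<close> lie in a common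
  hyperplane \<open>H\<close>, and the case \<open>H\<^sub>1 = H\<^sub>2 = H\<close> of the conclusion shows that \<open>H\<close> contains \<open>r\<close> points of
  \<open>X\<close>. Hence under the general position assumption \<open>W\<close> is automatically disjoint from \<open>V\<close>.\<close>

section \<open>Zeros of large depth\<close>

text \<open>Call a direction \<open>M\<close> shallow if at most \<open>r\<close> of the vectors \<open>g i\<close> have nonpositive inner product
  with it. By Caratheodory's theorem a convex combination of shallow directions that vanishes can be
  taken with at most \<open>dim S + 1\<close> terms. These directions exclude at most \<open>r * (dim S + 1)\<close> indices
  together, so a single \<open>g i\<close> is positive on all of them, and hence on their convex combination.\<close>

lemma zero_not_in_convex_hull_shallow:
  fixes g :: "'i \<Rightarrow> 'a::euclidean_space"
  assumes S: "subspace S" and J: "finite J" and big: "r * (dim S + 1) < card J"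
  shows "0 \<notin> convex hull {M\<in>S. card {i\<in>J. g i \<bullet> M \<le> 0} \<le> r}" (is "0 \<notin> convex hull ?T")
proof
  assume "0 \<in> convex hull ?T"
  then obtain T u where T: "finite T" "T \<subseteq> ?T" "int (card T) \<le> aff_dim ?T + 1"
    and u: "\<forall>M\<in>T. 0 \<le> u M" "sum u T = 1" "(\<Sum>M\<in>T. u M *\<^sub>R M) = 0"
    unfolding convex_hull_caratheodory_aff_dim by blast
  have "aff_dim ?T \<le> aff_dim S"
    by (rule aff_dim_subset) auto
  then have cT: "card T \<le> dim S + 1"
    using T(3) aff_dim_subspace[OF S] by linarith
  have "card (\<Union>M\<in>T. {i\<in>J. g i \<bullet> M \<le> 0}) \<le> (\<Sum>M\<in>T. card {i\<in>J. g i \<bullet> M \<le> 0})"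
    by (rule card_UN_le[OF T(1)])
  also have "\<dots> \<le> (\<Sum>M\<in>T. r)"
    using T(2) by (intro sum_mono) auto
  also have "\<dots> \<le> r * (dim S + 1)"
    using mult_le_mono2[OF cT, of r] by (simp add: mult.commute)
  finally have "card (\<Union>M\<in>T. {i\<in>J. g i \<bullet> M \<le> 0}) < card J"
    using big by simp
  then have "\<not> J \<subseteq> (\<Union>M\<in>T. {i\<in>J. g i \<bullet> M \<le> 0})"
    using card_mono[of "\<Union>M\<in>T. {i\<in>J. g i \<bullet> M \<le> 0}" J] T(1) J by auto
  then obtain i where "i \<in> J" "i \<notin> (\<Union>M\<in>T. {i\<in>J. g i \<bullet> M \<le> 0})"
    by blast
  then have i: "0 < g i \<bullet> M" if "M \<in> T" for M
    using that by (auto simp: not_le)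
  have "0 = g i \<bullet> (\<Sum>M\<in>T. u M *\<^sub>R M)"
    using u(3) by simp
  also have "\<dots> = (\<Sum>M\<in>T. u M * (g i \<bullet> M))"
    by (simp add: inner_sum_right)
  finally have "(\<Sum>M\<in>T. u M * (g i \<bullet> M)) = 0"
    by simp
  moreover have "0 \<le> u M * (g i \<bullet> M)" if "M \<in> T" for M
    using i[OF that] u(1) that by simp
  ultimately have "\<forall>M\<in>T. u M * (g i \<bullet> M) = 0"
    using T(1) by (simp add: sum_nonneg_eq_0_iff)
  then have "\<forall>M\<in>T. u M = 0"
    using i by fastforce
  then show False
    using u(2) by simp
qed

text \<open>A zero theorem for families of fields: for a single field and \<open>r = 0\<close> it says that a field which
  points outward on the sphere is orthogonal to \<open>S\<close> somewhere in the ball. If no \<open>L\<close> had the asserted property,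
  every \<open>L\<close> would have a shallow direction. A direction that is shallow at \<open>c\<close> remains so near \<open>c\<close>, so
  finitely many directions serve the whole ball, and averaging them with continuous weights gives a
  continuous field \<open>z\<close> of convex combinations of shallow directions. It has no zero by
  \<open>zero_not_in_convex_hull_shallow\<close>. On the sphere \<open>L\<close> itself is shallow at \<open>L\<close>, so \<open>z L\<close> never points
  against \<open>L\<close> there; but Brouwer's theorem, applied to \<open>- \<rho> z / |z|\<close>, finds a point where it does.\<close>

theorem deep_zero_exists:
  fixes g :: "'i \<Rightarrow> 'a::euclidean_space \<Rightarrow> 'a"
  assumes S: "subspace S" and J: "finite J" and big: "r * (dim S + 1) < card J"
    and \<rho>: "0 < \<rho>"
    and cont: "\<And>i. i \<in> J \<Longrightarrow> continuous_on (S \<inter> cball 0 \<rho>) (g i)"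
    and outward: "\<And>i L. i \<in> J \<Longrightarrow> L \<in> S \<Longrightarrow> norm L = \<rho> \<Longrightarrow> 0 < g i L \<bullet> L"
  shows "\<exists>L\<in>S. \<forall>M\<in>S. r < card {i\<in>J. g i L \<bullet> M \<le> 0}"
proof (rule ccontr)
  assume neg: "\<not> ?thesis"
  define B where "B = S \<inter> cball 0 \<rho>"
  define T where "T L = {M\<in>S. card {i\<in>J. g i L \<bullet> M \<le> 0} \<le> r}" for L
  have zero: "0 \<notin> convex hull (T L)" for L
    unfolding T_def by (rule zero_not_in_convex_hull_shallow[OF S J big])
  have B: "compact B" "convex B" "B \<noteq> {}"
    using S \<rho> subspace_0[OF S] unfolding B_def
    by (auto simp: closed_subspace closed_Int_compact subspace_imp_convex convex_Int)
  obtain m where m: "\<And>L. L \<in> B \<Longrightarrow> m L \<in> T L"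
  proof -
    have "\<exists>M. M \<in> T L" if "L \<in> B" for L
      using neg that unfolding B_def T_def by (auto simp: not_less)
    then have "(SOME M. M \<in> T L) \<in> T L" if "L \<in> B" for L
      using that by (simp add: some_in_eq ex_in_conv)
    then show ?thesis by (rule that)
  qed
  define I where "I c = {i\<in>J. 0 < g i c \<bullet> m c}" for c
  define O' where "O' c = {L\<in>B. \<forall>i\<in>I c. 0 < g i L \<bullet> m c}" for c
  have "openin (top_of_set B) (O' c)" for c
  proof -
    have "O' c = B \<inter> (\<Inter>i\<in>I c. {L\<in>B. 0 < g i L \<bullet> m c})"
      unfolding O'_def by auto
    moreover have "openin (top_of_set B) (B \<inter> (\<Inter>i\<in>I c. {L\<in>B. 0 < g i L \<bullet> m c}))"
    proof (rule openin_Int_Inter)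
      show "finite ((\<lambda>i. {L\<in>B. 0 < g i L \<bullet> m c}) ` I c)"
        using J unfolding I_def by simp
      show "openin (top_of_set B) U" if U: "U \<in> (\<lambda>i. {L\<in>B. 0 < g i L \<bullet> m c}) ` I c" for U
      proof -
        from U obtain i where i: "i \<in> J" "U = {L\<in>B. 0 < g i L \<bullet> m c}"
          unfolding I_def by auto
        have "continuous_on B (\<lambda>L. g i L \<bullet> m c)"
          using cont[OF i(1)] unfolding B_def by (intro continuous_intros)
        from continuous_openin_preimage_gen[OF this, of "{0<..}"]
        show ?thesis unfolding i(2) by (simp add: vimage_def Int_def)
      qed
    qed simp
    ultimately show ?thesis by simp
  qed
  moreover have "B \<subseteq> \<Union>(O' ` B)"
    unfolding O'_def I_def by auto
  ultimately obtain F where F: "finite F" "F \<subseteq> B" "B \<subseteq> \<Union>(O' ` F)"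
    using B(1) unfolding compact_eq_openin_cover
    by (metis (no_types, lifting) finite_subset_image imageE)
  \<comment> \<open>This weight is positive exactly on the relatively open set where every \<open>i\<close> that is positive
    on \<open>m c\<close> at \<open>c\<close> is still positive, so that \<open>m c\<close> is still shallow there.\<close>
  define w where "w c L = (\<Prod>i\<in>I c. max 0 (g i L \<bullet> m c))" for c L
  have w_nonneg: "0 \<le> w c L" for c L
    unfolding w_def by (intro prod_nonneg) auto
  have w_pos: "\<exists>c\<in>F. 0 < w c L" if L: "L \<in> B" for L
    using F(3) L unfolding O'_def w_def by (fastforce intro!: prod_pos)
  have mT: "m c \<in> T L" if "c \<in> F" "w c L \<noteq> 0" for c L
  proof -
    have "finite (I c)" using J unfolding I_def by simp
    then have "{i\<in>J. g i L \<bullet> m c \<le> 0} \<subseteq> {i\<in>J. g i c \<bullet> m c \<le> 0}"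
      using that(2) unfolding w_def I_def by (auto simp: max_def split: if_splits)
    then have "card {i\<in>J. g i L \<bullet> m c \<le> 0} \<le> card {i\<in>J. g i c \<bullet> m c \<le> 0}"
      using J by (intro card_mono) auto
    then show ?thesis
      using m[of c] that(1) F(2) unfolding T_def by auto
  qed
  define W where "W L = (\<Sum>c\<in>F. w c L)" for L
  define z where "z L = (\<Sum>c\<in>F. (w c L / W L) *\<^sub>R m c)" for L
  have W: "0 < W L" if "L \<in> B" for L
    unfolding W_def using w_pos[OF that] F(1) w_nonneg by (metis sum_pos2)
  have zT: "z L \<in> convex hull (T L)" if L: "L \<in> B" for L
  proof -
    define G where "G = {c\<in>F. w c L \<noteq> 0}"
    have "z L = (\<Sum>c\<in>G. (w c L / W L) *\<^sub>R m c)"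
      unfolding z_def G_def using F(1) by (intro sum.mono_neutral_right) auto
    also have "\<dots> \<in> convex hull (T L)"
    proof (rule convex_sum)
      have "(\<Sum>c\<in>G. w c L / W L) = (\<Sum>c\<in>F. w c L / W L)"
        unfolding G_def using F(1) by (intro sum.mono_neutral_left) auto
      also have "\<dots> = 1"
        using W[OF L] by (simp add: W_def flip: sum_divide_distrib)
      finally show "(\<Sum>c\<in>G. w c L / W L) = 1" .
    qed (use F(1) W[OF L] w_nonneg mT in \<open>auto simp: G_def hull_inc\<close>)
    finally show ?thesis .
  qed
  then have z0: "z L \<noteq> 0" if "L \<in> B" for L
    using zero[of L] that by metis
  have zS: "z L \<in> S" if "L \<in> B" for L
  proof -
    have "convex hull (T L) \<subseteq> S"
      by (rule hull_minimal) (auto simp: T_def subspace_imp_convex[OF S])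
    then show ?thesis using zT[OF that] by auto
  qed
  have "continuous_on B z"
  proof -
    have w_cont: "continuous_on B (w c)" for c
      unfolding w_def using cont unfolding B_def I_def
      by (intro continuous_intros) auto
    then have "continuous_on B W"
      unfolding W_def by (intro continuous_intros)
    then show ?thesis
      unfolding z_def using w_cont W by (intro continuous_intros) force+
  qed
  then have "continuous_on B (\<lambda>L. - (\<rho> / norm (z L)) *\<^sub>R z L)"
    using z0 by (intro continuous_intros) auto
  moreover have "(\<lambda>L. - (\<rho> / norm (z L)) *\<^sub>R z L) \<in> B \<rightarrow> B"
    unfolding B_def using zS z0 S \<rho> by (auto simp: subspace_scale subspace_neg B_def)
  ultimately obtain L where "L \<in> B" "- (\<rho> / norm (z L)) *\<^sub>R z L = L"
    by (rule brouwer[OF B])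
  then have L: "L \<in> B" "L = - (\<rho> / norm (z L)) *\<^sub>R z L"
    by simp_all
  have nz: "0 < norm (z L)"
    using z0[OF L(1)] by simp
  have normL: "norm L = \<rho>"
    using \<rho> nz by (subst L(2)) simp
  then have "{i\<in>J. g i L \<bullet> L \<le> 0} = {}"
    using outward L(1) unfolding B_def by fastforce
  then have "L \<in> T L"
    using L(1) unfolding T_def B_def by (simp only: mem_Collect_eq) simp
  then have LT: "L \<in> convex hull (T L)"
    by (rule hull_inc)
  \<comment> \<open>At the fixed point, \<open>z L\<close> and \<open>L\<close> are opposite, so that the origin is on the segment between them.\<close>
  define \<mu> where "\<mu> = \<rho> / norm (z L)"
  have \<mu>: "0 < \<mu>" unfolding \<mu>_def using \<rho> nz by simp
  have "(\<mu> / (1 + \<mu>)) *\<^sub>R z L + (1 / (1 + \<mu>)) *\<^sub>R L \<in> convex hull (T L)"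
    by (rule convexD[OF convex_convex_hull zT[OF L(1)] LT])
       (use \<mu> in \<open>auto simp: add_divide_distrib[symmetric]\<close>)
  moreover have "(\<mu> / (1 + \<mu>)) *\<^sub>R z L + (1 / (1 + \<mu>)) *\<^sub>R L = 0"
  proof -
    have "L = - (\<mu> *\<^sub>R z L)"
      using L(2) unfolding \<mu>_def by simp
    then have "(1 / (1 + \<mu>)) *\<^sub>R L = (1 / (1 + \<mu>)) *\<^sub>R (- (\<mu> *\<^sub>R z L))"
      by (rule arg_cong)
    then show ?thesis by simp
  qed
  ultimately show False
    using zero by metis
qed

section \<open>Balanced linear subspaces\<close>

definition outer_product :: "real ^ 'm \<Rightarrow> real ^ 'n \<Rightarrow> real ^ 'n ^ 'm" where
  "outer_product b a = (\<chi> i j. b $ i * a $ j)"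

lemma outer_product_vector_mult: "outer_product b a *v x = (a \<bullet> x) *\<^sub>R b"
  by (simp add: outer_product_def vec_eq_iff matrix_vector_mult_def inner_vec_def sum_distrib_left mult_ac)

lemma inner_outer_product: "outer_product b a \<bullet> A = b \<bullet> (A *v a)"
  by (simp add: outer_product_def inner_vec_def matrix_vector_mult_def sum_distrib_left mult_ac)

lemma linear_outer_product_left: "linear (\<lambda>b. outer_product b a)"
  by (rule linearI) (simp_all add: outer_product_def vec_eq_iff algebra_simps)

lemma linear_outer_product_right: "linear (outer_product b)"
  by (rule linearI) (simp_all add: outer_product_def vec_eq_iff algebra_simps)

lemma linear_matrix_apply: "linear (\<lambda>A :: real ^ 'n ^ 'm. A *v x)"
  by (rule linearI) (simp_all add: matrix_vector_mult_add_rdistrib scaleR_matrix_vector_assoc)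

text \<open>Let \<open>U\<close> be the orthogonal complement of \<open>V\<close>. A linear map \<open>A\<close> from \<open>U\<close> to \<open>V\<close>, extended by \<open>0\<close> to
  \<open>V\<close>, has as its graph a complement of \<open>V\<close>, and the normal vectors of this graph are the
  \<open>b - A\<^sup>T b\<close> with \<open>b \<in> V\<close>. These maps form the space \<open>S\<close> spanned by the matrices \<open>b a\<^sup>T\<close> with \<open>b \<in> V\<close>
  and \<open>a \<in> U\<close>, of dimension at most \<open>dim V * dim U\<close>. The gradient of half the squared distance of \<open>A x\<close>
  and \<open>x\<close> is \<open>(A x - x) x\<^sup>T\<close>, and its inner product with \<open>b a\<^sup>T\<close> is
  \<open>- ((b - A\<^sup>T b) \<bullet> x) * (a \<bullet> x)\<close>: the rank one directions are exactly the pairs of hyperplanes. So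
  the depth statement for the gradients at a suitable \<open>A\<close> is the desired one.

  The gradients alone need not point outward on any sphere, since some \<open>x i\<close> may be annihilated by
  many \<open>A\<close>; the term \<open>\<epsilon> A\<close> is added for this. Its contribution \<open>\<epsilon> * (b \<bullet> A a)\<close> could be unbounded, as
  \<open>A\<close> depends on \<open>\<epsilon>\<close>, but in terms of the normal vector \<open>\<beta> = b - A\<^sup>T b\<close> it is \<open>- \<epsilon> * (\<beta> \<bullet> a)\<close>, which is
  harmless for normalised \<open>\<beta>\<close>.\<close>

lemma perturbed_balanced_subspace:
  fixes V :: "(real ^ 'n) set" and x :: "'i \<Rightarrow> real ^ 'n"
  assumes V: "subspace V" and J: "finite J"
    and big: "s * (dim V * (CARD('n) - dim V) + 1) < card J" and \<epsilon>: "0 < \<epsilon>"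
  shows "\<exists>N. subspace N \<and> dim N = dim V \<and>
    (\<forall>\<beta>\<in>N. \<forall>a. (\<forall>v\<in>V. orthogonal v a) \<longrightarrow>
       s < card {i\<in>J. 0 \<le> (\<beta> \<bullet> x i) * (a \<bullet> x i) + \<epsilon> * (\<beta> \<bullet> a)})"
proof -
  define U where "U = {a. \<forall>v\<in>V. orthogonal v a}"
  have U: "subspace U"
    unfolding U_def by (simp add: subspace_orthogonal_to_vectors)
  have dimU: "dim U = CARD('n) - dim V"
    using dim_subspace_orthogonal_to_vectors[OF V subspace_UNIV] unfolding U_def by simp
  obtain BV where BV: "BV \<subseteq> V" "independent BV" "V \<subseteq> span BV" "card BV = dim V"
    using basis_exists[of V] by blast
  obtain BU where BU: "BU \<subseteq> U" "independent BU" "U \<subseteq> span BU" "card BU = dim U"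
    using basis_exists[of U] by blast
  have fin: "finite BV" "finite BU"
    using BV(2) BU(2) by (auto dest: finiteI_independent)
  define O' where "O' = (\<lambda>(b, a). outer_product b a) ` (BV \<times> BU)"
  define S where "S = span O'"
  have S: "subspace S"
    unfolding S_def by (rule subspace_span)
  have "dim S \<le> card O'"
    unfolding S_def O'_def using fin by (intro dim_le_card) auto
  also have "\<dots> \<le> dim V * dim U"
    unfolding O'_def using card_image_le[of "BV \<times> BU" "\<lambda>(b, a). outer_product b a"] fin BV(4) BU(4)
    by (simp add: card_cartesian_product)
  finally have dimS: "dim S + 1 \<le> dim V * (CARD('n) - dim V) + 1"
    by (simp add: dimU)
  have bigS: "s * (dim S + 1) < card J"
    using mult_le_mono2[OF dimS] big by (rule le_less_trans)
  have opS: "outer_product b a \<in> S" if b: "b \<in> V" and a: "a \<in> U" for b a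
  proof -
    have *: "outer_product c a \<in> S" if c: "c \<in> BV" for c
    proof -
      have "BU \<subseteq> outer_product c -` S"
        using c unfolding S_def O'_def by (auto intro: span_base)
      then have "span BU \<subseteq> outer_product c -` S"
        by (rule span_minimal) (rule linear_subspace_vimage[OF linear_outer_product_right S])
      then show ?thesis using a BU(3) by auto
    qed
    have "span BV \<subseteq> (\<lambda>c. outer_product c a) -` S"
      using * by (intro span_minimal linear_subspace_vimage[OF linear_outer_product_left S]) auto
    then show ?thesis using b BV(3) by auto
  qed
  have Sprop: "(\<forall>y. A *v y \<in> V) \<and> (\<forall>v\<in>V. A *v v = 0)" if "A \<in> S" for A
  proof -
    have "subspace {A :: real^'n^'n. (\<forall>y. A *v y \<in> V) \<and> (\<forall>v\<in>V. A *v v = 0)}"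
      using V by (auto simp: subspace_def matrix_vector_mult_add_rdistrib
          scaleR_matrix_vector_assoc[symmetric])
    moreover have "O' \<subseteq> {A. (\<forall>y. A *v y \<in> V) \<and> (\<forall>v\<in>V. A *v v = 0)}"
      using BV(1) BU(1) V unfolding O'_def U_def
      by (auto simp: outer_product_vector_mult subspace_scale orthogonal_def inner_commute subset_eq)
    ultimately show ?thesis
      using that span_minimal[of O'] unfolding S_def by blast
  qed
  define g where "g i A = outer_product (A *v x i - x i) (x i) + \<epsilon> *\<^sub>R A" for i and A :: "real^'n^'n"
  have g_inner: "g i A \<bullet> M = (A *v x i - x i) \<bullet> (M *v x i) + \<epsilon> * (A \<bullet> M)" for i A M
    by (simp add: g_def inner_add_left inner_outer_product)
  define R where "R = (\<Sum>i\<in>J. x i \<bullet> x i)"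
  \<comment> \<open>Any radius with \<open>\<epsilon> * \<rho>\<^sup>2 > R\<close> works; this one has it because \<open>\<rho> \<ge> 1\<close>.\<close>
  define \<rho> where "\<rho> = R / \<epsilon> + 1"
  have R0: "0 \<le> R" unfolding R_def by (simp add: sum_nonneg)
  have \<rho>: "1 \<le> \<rho>" unfolding \<rho>_def using R0 \<epsilon> by simp
  have "\<exists>A\<in>S. \<forall>M\<in>S. s < card {i\<in>J. g i A \<bullet> M \<le> 0}"
  proof (rule deep_zero_exists[OF S J bigS])
    show "0 < \<rho>" using \<rho> by simp
    show "continuous_on (S \<inter> cball 0 \<rho>) (g i)" for i
    proof -
      have 1: "continuous_on (S \<inter> cball 0 \<rho>) (\<lambda>A. A *v x i)"
        using linear_matrix_apply by (intro linear_continuous_on) (simp add: linear_linear)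
      have 2: "continuous_on UNIV (\<lambda>b. outer_product b (x i))"
        using linear_outer_product_left by (intro linear_continuous_on) (simp add: linear_linear)
      show ?thesis
        unfolding g_def
        by (intro continuous_intros continuous_on_compose2[OF 2] 1) auto
    qed
    show "0 < g i A \<bullet> A" if i: "i \<in> J" and A: "A \<in> S" "norm A = \<rho>" for i A
    proof -
      \<comment> \<open>Completing the square bounds \<open>|A x|\<^sup>2 - x \<bullet> A x\<close> from below.\<close>
      have "0 \<le> (2 *\<^sub>R (A *v x i) - x i) \<bullet> (2 *\<^sub>R (A *v x i) - x i)"
        by (rule inner_ge_zero)
      then have 1: "- (x i \<bullet> x i) \<le> 4 * ((A *v x i - x i) \<bullet> (A *v x i))"
        by (simp add: inner_diff_left inner_diff_right inner_commute algebra_simps)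
      have "x i \<bullet> x i \<le> R"
        unfolding R_def using i J by (intro member_le_sum) auto
      also have "R < \<epsilon> * \<rho>"
        unfolding \<rho>_def using \<epsilon> by (simp add: field_simps)
      also have "\<epsilon> * \<rho> \<le> \<epsilon> * (\<rho> * \<rho>)"
        using \<epsilon> \<rho> by (intro mult_left_mono) auto
      finally have "x i \<bullet> x i < \<epsilon> * (A \<bullet> A)"
        using A(2) by (simp add: dot_square_norm power2_eq_square)
      moreover have "0 \<le> x i \<bullet> x i" by simp
      ultimately show ?thesis
        using 1 unfolding g_inner by linarith
    qed
  qed
  then obtain A where A: "A \<in> S" and deep: "\<And>M. M \<in> S \<Longrightarrow> s < card {i\<in>J. g i A \<bullet> M \<le> 0}"
    by blast
  define f where "f b = b - transpose A *v b" for b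
  have f_inner: "f b \<bullet> y = b \<bullet> y - b \<bullet> (A *v y)" for b y
    by (simp add: f_def inner_diff_left dot_lmul_matrix)
  have f_lin: "linear f"
    unfolding f_def by (intro linear_compose_sub matrix_vector_mul_linear linear_ident)
  have f_inj: "inj_on f V"
  proof (rule inj_onI)
    fix b c assume bc: "b \<in> V" "c \<in> V" "f b = f c"
    have "f (b - c) = 0"
      using bc(3) by (simp add: linear_diff[OF f_lin])
    moreover have "A *v (b - c) = 0"
      using Sprop[OF A] bc V by (auto simp: subspace_diff)
    ultimately show "b = c"
      using f_inner[of "b - c" "b - c"] by simp
  qed
  have "s < card {i\<in>J. 0 \<le> (f b \<bullet> x i) * (a \<bullet> x i) + \<epsilon> * (f b \<bullet> a)}"
    if b: "b \<in> V" and a: "\<forall>v\<in>V. orthogonal v a" for b a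
  proof -
    have ba: "b \<bullet> a = 0"
      using a b by (simp add: orthogonal_def)
    have "g i A \<bullet> outer_product b a = - ((f b \<bullet> x i) * (a \<bullet> x i) + \<epsilon> * (f b \<bullet> a))" for i
      unfolding g_inner f_inner outer_product_vector_mult ba inner_commute[of A] inner_outer_product
      by (simp add: inner_diff_left inner_commute algebra_simps)
    then have "g i A \<bullet> outer_product b a \<le> 0 \<longleftrightarrow> 0 \<le> (f b \<bullet> x i) * (a \<bullet> x i) + \<epsilon> * (f b \<bullet> a)" for i
      by (simp only: neg_le_0_iff_le)
    then show ?thesis
      using deep[OF opS[OF b, of a]] a unfolding U_def by simp
  qed
  moreover have "subspace (f ` V)"
    using f_lin V by (rule linear_subspace_image)
  moreover have "dim (f ` V) = dim V"
    using dim_image_eq[OF f_lin] f_inj V by (simp add: span_eq_iff[THEN iffD2])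
  ultimately show ?thesis
    by (intro exI[of _ "f ` V"]) auto
qed

text \<open>Compactness of the Grassmannian. An orthonormal basis of each \<open>N j\<close> is stored in the rows, indexed
  by a fixed set \<open>K\<close>, of one matrix; a limit of these matrices again has orthonormal rows, so
  the dimension does not drop.\<close>

lemma subspaces_subconverge:
  fixes N :: "nat \<Rightarrow> (real ^ 'n) set"
  assumes N: "\<And>j. subspace (N j)" "\<And>j. dim (N j) = k"
  obtains N' and \<sigma> :: "nat \<Rightarrow> nat" where "strict_mono \<sigma>" "subspace N'" "dim N' = k"
    "\<And>\<beta>. \<beta> \<in> N' \<Longrightarrow> \<exists>\<gamma>. (\<forall>j. \<gamma> j \<in> N (\<sigma> j)) \<and> \<gamma> \<longlonglongrightarrow> \<beta>"
proof -
  have "k \<le> CARD('n)"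
    using dim_subset_UNIV[of "N 0"] N(2) by simp
  then obtain K :: "'n set" where K: "card K = k"
    using obtain_subset_with_card_n[of k "UNIV :: 'n set"] by auto
  have "\<exists>M :: real^'n^'n. (\<forall>i\<in>K. M $ i \<in> N j) \<and>
      (\<forall>i\<in>K. \<forall>i'\<in>K. M $ i \<bullet> M $ i' = (if i = i' then 1 else 0)) \<and> (\<forall>i. norm (M $ i) \<le> 1)" for j
  proof -
    obtain B where B: "B \<subseteq> N j" "pairwise orthogonal B" "\<And>x. x \<in> B \<Longrightarrow> norm x = 1"
      "independent B" "card B = dim (N j)"
      using orthonormal_basis_subspace[OF N(1)[of j]] by metis
    obtain h where h: "bij_betw h K B"
      using finite_same_card_bij[of K B] K B(4,5) N(2) by (auto dest: finiteI_independent)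
    then have hB: "h i \<in> B" if "i \<in> K" for i
      using that by (auto dest: bij_betwE)
    have "h i \<bullet> h i' = (if i = i' then 1 else 0)" if "i \<in> K" "i' \<in> K" for i i'
    proof (cases "i = i'")
      case True
      then show ?thesis
        using B(3)[OF hB[OF that(1)]] by (simp add: norm_eq_1)
    next
      case False
      then have "h i \<noteq> h i'"
        using h that by (auto simp: bij_betw_def inj_on_def)
      then show ?thesis
        using False B(2) hB that by (auto simp: pairwise_def orthogonal_def)
    qed
    then show ?thesis
      using hB B(1) B(3) by (intro exI[of _ "\<chi> i. if i \<in> K then h i else 0"]) auto
  qed
  then obtain M :: "nat \<Rightarrow> real^'n^'n" where
    MN: "\<And>j i. i \<in> K \<Longrightarrow> M j $ i \<in> N j"
    and orth: "\<And>j i i'. i \<in> K \<Longrightarrow> i' \<in> K \<Longrightarrow> M j $ i \<bullet> M j $ i' = (if i = i' then 1 else 0)"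
    and le1: "\<And>j i. norm (M j $ i) \<le> 1"
    by metis
  have "M j \<in> cball 0 (real CARD('n))" for j
  proof -
    have "norm (M j) \<le> (\<Sum>i\<in>UNIV. norm (M j $ i))"
      unfolding norm_vec_def by (rule L2_set_le_sum) simp
    also have "\<dots> \<le> (\<Sum>i\<in>(UNIV :: 'n set). 1)"
      by (intro sum_mono le1)
    finally show ?thesis by simp
  qed
  then obtain M' and \<sigma> :: "nat \<Rightarrow> nat" where \<sigma>: "strict_mono \<sigma>" and lim: "(M \<circ> \<sigma>) \<longlonglongrightarrow> M'"
    using seq_compactE[OF compact_imp_seq_compact[OF compact_cball]] by metis
  have lim_row: "(\<lambda>j. M (\<sigma> j) $ i) \<longlonglongrightarrow> M' $ i" for i
    using tendsto_vec_nth[OF lim] by simp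
  have orth': "M' $ i \<bullet> M' $ i' = (if i = i' then 1 else 0)" if "i \<in> K" "i' \<in> K" for i i'
    using tendsto_inner[OF lim_row[of i] lim_row[of i']] orth[OF that]
    by (simp add: LIMSEQ_const_iff)
  have inj: "inj_on (($) M') K"
  proof (rule inj_onI)
    fix i i' assume "i \<in> K" "i' \<in> K" "M' $ i = M' $ i'"
    then show "i = i'"
      using orth'[of i i'] orth'[of i i] by (auto split: if_splits)
  qed
  have "pairwise orthogonal ((($) M') ` K)" "0 \<notin> (($) M') ` K"
    using orth' by (fastforce simp: pairwise_def orthogonal_def)+
  then have "independent ((($) M') ` K)"
    by (rule pairwise_orthogonal_independent)
  then have dim: "dim (span ((($) M') ` K)) = k"
    using dim_span_eq_card_independent card_image[OF inj] K by metis
  show ?thesis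
  proof (rule that[OF \<sigma> subspace_span dim])
    fix \<beta> assume "\<beta> \<in> span ((($) M') ` K)"
    then obtain u where "\<beta> = (\<Sum>v\<in>(($) M') ` K. u v *\<^sub>R v)"
      by (auto simp: span_finite)
    then have \<beta>: "\<beta> = (\<Sum>i\<in>K. u (M' $ i) *\<^sub>R M' $ i)"
      by (simp add: sum.reindex[OF inj])
    have "(\<lambda>j. \<Sum>i\<in>K. u (M' $ i) *\<^sub>R M (\<sigma> j) $ i) \<longlonglongrightarrow> \<beta>"
      unfolding \<beta> by (intro tendsto_intros lim_row)
    moreover have "(\<Sum>i\<in>K. u (M' $ i) *\<^sub>R M (\<sigma> j) $ i) \<in> N (\<sigma> j)" for j
      using MN N(1) by (intro subspace_sum subspace_scale) auto
    ultimately show "\<exists>\<gamma>. (\<forall>j. \<gamma> j \<in> N (\<sigma> j)) \<and> \<gamma> \<longlonglongrightarrow> \<beta>"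
      by (intro exI[of _ "\<lambda>j. \<Sum>i\<in>K. u (M' $ i) *\<^sub>R M (\<sigma> j) $ i"]) auto
  qed
qed

text \<open>The limit of \<open>perturbed_balanced_subspace\<close> for \<open>\<epsilon> \<longlonglongrightarrow> 0\<close>. The graphs may become ever steeper, so
  the limit is taken of their normal spaces, and the orthogonal complement of the limit may meet \<open>V\<close>.
  An index with a negative product in the limit has a negative perturbed product eventually, so
  the counts survive.\<close>

theorem balanced_subspace_exists:
  fixes V :: "(real ^ 'n) set" and x :: "'i \<Rightarrow> real ^ 'n"
  assumes V: "subspace V" and J: "finite J"
    and big: "s * (dim V * (CARD('n) - dim V) + 1) < card J"
  shows "\<exists>N. subspace N \<and> dim N = dim V \<and>
    (\<forall>\<beta>\<in>N. \<forall>a\<in>V\<^sup>\<bottom>. s < card {i\<in>J. 0 \<le> (\<beta> \<bullet> x i) * (a \<bullet> x i)})"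
proof -
  define \<epsilon> :: "nat \<Rightarrow> real" where "\<epsilon> j = inverse (real (Suc j))" for j
  have \<epsilon>_pos: "0 < \<epsilon> j" for j
    unfolding \<epsilon>_def by simp
  define Q where "Q j N \<longleftrightarrow> subspace N \<and> dim N = dim V \<and>
    (\<forall>\<beta>\<in>N. \<forall>a. (\<forall>v\<in>V. orthogonal v a) \<longrightarrow>
      s < card {i\<in>J. 0 \<le> (\<beta> \<bullet> x i) * (a \<bullet> x i) + \<epsilon> j * (\<beta> \<bullet> a)})" for j N
  have "\<exists>N. Q j N" for j
    unfolding Q_def by (rule perturbed_balanced_subspace[OF V J big \<epsilon>_pos])
  then obtain N where Q: "\<And>j. Q j (N j)"
    by metis
  then have N: "subspace (N j)" "dim (N j) = dim V"
    and deep: "\<beta> \<in> N j \<Longrightarrow> \<forall>v\<in>V. orthogonal v a \<Longrightarrow>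
      s < card {i\<in>J. 0 \<le> (\<beta> \<bullet> x i) * (a \<bullet> x i) + \<epsilon> j * (\<beta> \<bullet> a)}" for j \<beta> a
    unfolding Q_def by blast+
  obtain N' and \<sigma> :: "nat \<Rightarrow> nat" where \<sigma>: "strict_mono \<sigma>" and N': "subspace N'" "dim N' = dim V"
    and approx: "\<And>\<beta>. \<beta> \<in> N' \<Longrightarrow> \<exists>\<gamma>. (\<forall>j. \<gamma> j \<in> N (\<sigma> j)) \<and> \<gamma> \<longlonglongrightarrow> \<beta>"
    by (rule subspaces_subconverge[of N, OF N]) blast
  have "\<epsilon> \<longlonglongrightarrow> 0"
    unfolding \<epsilon>_def by (rule LIMSEQ_inverse_real_of_nat)
  then have \<epsilon>_lim: "(\<lambda>j. \<epsilon> (\<sigma> j)) \<longlonglongrightarrow> 0"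
    using LIMSEQ_subseq_LIMSEQ[OF _ \<sigma>] by (fastforce simp: o_def)
  have "s < card {i\<in>J. 0 \<le> (\<beta> \<bullet> x i) * (a \<bullet> x i)}" if \<beta>: "\<beta> \<in> N'" and a: "a \<in> V\<^sup>\<bottom>" for \<beta> a
  proof -
    obtain \<gamma> where \<gamma>: "\<And>j. \<gamma> j \<in> N (\<sigma> j)" "\<gamma> \<longlonglongrightarrow> \<beta>"
      using approx[OF \<beta>] by blast
    define q where "q i j = (\<gamma> j \<bullet> x i) * (a \<bullet> x i) + \<epsilon> (\<sigma> j) * (\<gamma> j \<bullet> a)" for i j
    have q_lim: "q i \<longlonglongrightarrow> (\<beta> \<bullet> x i) * (a \<bullet> x i) + 0 * (\<beta> \<bullet> a)" for i
      unfolding q_def by (intro tendsto_intros \<gamma>(2) \<epsilon>_lim)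
    have "\<forall>\<^sub>F j in sequentially. \<forall>i\<in>{i\<in>J. (\<beta> \<bullet> x i) * (a \<bullet> x i) < 0}. q i j < 0"
    proof (rule eventually_ball_finite)
      show "\<forall>i\<in>{i\<in>J. (\<beta> \<bullet> x i) * (a \<bullet> x i) < 0}. \<forall>\<^sub>F j in sequentially. q i j < 0"
        using order_tendstoD(2)[OF q_lim, of _ 0] by auto
    qed (use J in auto)
    then obtain j where j: "\<forall>i\<in>{i\<in>J. (\<beta> \<bullet> x i) * (a \<bullet> x i) < 0}. q i j < 0"
      using eventually_happens by fastforce
    have "s < card {i\<in>J. 0 \<le> q i j}"
      unfolding q_def using a by (intro deep[OF \<gamma>(1)]) (simp add: orthogonal_comp_def)
    also have "\<dots> \<le> card {i\<in>J. 0 \<le> (\<beta> \<bullet> x i) * (a \<bullet> x i)}"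
      using J j by (intro card_mono) (auto simp: not_le[symmetric])
    finally show ?thesis .
  qed
  then show ?thesis
    using N' by (intro exI[of _ N']) auto
qed

section \<open>Hyperplanes and parts of projective space\<close>

lemma line_of_proj_pt: "x \<noteq> 0 \<Longrightarrow> line_of (proj_pt x) = span {x}"
  unfolding proj_pt_def by (rule Abs_rproj_inverse) auto

lemma proj_pt_cases:
  obtains x where "x \<noteq> 0" "p = proj_pt x"
proof -
  obtain x where "x \<noteq> 0" "line_of p = span {x}"
    using line_of[of p] by auto
  then show ?thesis
    using that[of x] line_of_proj_pt[of x] line_of_inject[of p "proj_pt x"] by simp
qed

lemma proj_pt_minus: "proj_pt (- x) = proj_pt x"
  unfolding proj_pt_def using span_image_scale[of "{x}" "\<lambda>_. -1"] by simp

definition proj_of :: "'a::euclidean_space set \<Rightarrow> 'a rproj set" where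
  "proj_of S = {p. line_of p \<subseteq> S}"

lemma proj_pt_in_proj_of: "subspace S \<Longrightarrow> x \<noteq> 0 \<Longrightarrow> proj_pt x \<in> proj_of S \<longleftrightarrow> x \<in> S"
  unfolding proj_of_def
  using span_minimal[of "{x}" S] span_superset[of "{x}"] by (auto simp: line_of_proj_pt)

lemma proj_of_subset_iff:
  assumes "subspace S" "subspace T"
  shows "proj_of S \<subseteq> proj_of T \<longleftrightarrow> S \<subseteq> T"
proof
  assume *: "proj_of S \<subseteq> proj_of T"
  show "S \<subseteq> T"
  proof
    fix x assume "x \<in> S"
    then show "x \<in> T"
      using * proj_pt_in_proj_of assms by (cases "x = 0") (auto simp: subspace_0)
  qed
qed (auto simp: proj_of_def)

lemma proj_hyperplane_iff:
  "proj_hyperplane H \<longleftrightarrow> (\<exists>a. a \<noteq> 0 \<and> H = proj_of ({a}\<^sup>\<bottom>))"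
proof
  fix H :: "'a rproj set"
  assume "proj_hyperplane H"
  then obtain T where T: "subspace T" "int (dim T) = int DIM('a) - 1" "H = proj_of T"
    unfolding proj_hyperplane_def proj_subspace_def proj_of_def by auto
  then have "dim T < DIM('a)"
    by linarith
  then obtain a where a: "a \<noteq> 0" "span T \<subseteq> {x. a \<bullet> x = 0}"
    using lowdim_subset_hyperplane by blast
  have "T = {a}\<^sup>\<bottom>"
  proof (rule subspace_dim_equal[OF T(1) subspace_orthogonal_comp])
    show "T \<subseteq> {a}\<^sup>\<bottom>"
      using a(2) span_superset[of T] by (auto simp: orthogonal_comp_def orthogonal_def)
    have "{a}\<^sup>\<bottom> = {x. a \<bullet> x = 0}"
      by (simp add: orthogonal_comp_def orthogonal_def)
    then show "dim T \<ge> dim ({a}\<^sup>\<bottom>)"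
      using T(2) dim_hyperplane[OF a(1)] by simp
  qed
  then show "\<exists>a. a \<noteq> 0 \<and> H = proj_of ({a}\<^sup>\<bottom>)"
    using T(3) a(1) by blast
next
  assume "\<exists>a. a \<noteq> 0 \<and> H = proj_of ({a}\<^sup>\<bottom>)"
  then obtain a where a: "a \<noteq> 0" "H = proj_of ({a}\<^sup>\<bottom>)" by blast
  have "{a}\<^sup>\<bottom> = {x. a \<bullet> x = 0}"
    by (simp add: orthogonal_comp_def orthogonal_def)
  then have "int (dim ({a}\<^sup>\<bottom>)) = int DIM('a) - 1"
    using dim_hyperplane[OF a(1)] by (simp add: Suc_leI of_nat_diff)
  then show "proj_hyperplane H"
    unfolding proj_hyperplane_def proj_subspace_def a(2) proj_of_def
    using subspace_orthogonal_comp by (intro exI[of _ "{a}\<^sup>\<bottom>"]) auto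
qed

lemma continuous_on_proj_pt: "continuous_on (- {0 :: 'a::euclidean_space}) proj_pt"
proof -
  have "open (proj_pt -` U \<inter> - {0 :: 'a})" if "open U" for U
  proof -
    have "proj_pt -` U \<inter> - {0 :: 'a} = {x. x \<noteq> 0 \<and> proj_pt x \<in> U}"
      by auto
    then show ?thesis
      using that by (simp add: open_rproj_def)
  qed
  then show ?thesis
    by (simp add: continuous_on_open_vimage open_Compl)
qed

text \<open>For linearly independent \<open>a\<close> and \<open>b\<close>, one of the two open parts cut out by their orthogonal
  hyperplanes; the other one is \<open>wedge a (- b)\<close>. In the vector space such a part is a double wedge, but either half of it already
  has all its projective points, and a half is convex.\<close>

definition wedge :: "'a::euclidean_space \<Rightarrow> 'a \<Rightarrow> 'a rproj set" where
  "wedge a b = proj_pt ` {x. 0 < a \<bullet> x \<and> 0 < b \<bullet> x}"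

lemma connected_wedge: "connected (wedge a b)"
  unfolding wedge_def
proof (rule connected_continuous_image)
  show "continuous_on {x. 0 < a \<bullet> x \<and> 0 < b \<bullet> x} proj_pt"
    by (rule continuous_on_subset[OF continuous_on_proj_pt]) auto
  have "convex ({x. 0 < a \<bullet> x} \<inter> {x. 0 < b \<bullet> x})"
    by (intro convex_Int convex_halfspace_gt)
  then show "connected {x. 0 < a \<bullet> x \<and> 0 < b \<bullet> x}"
    by (simp add: Int_def convex_connected)
qed

text \<open>Strictness in the Cauchy-Schwarz inequality provides a vector \<open>y\<close> that is positive on both \<open>a\<close>
  and \<open>b\<close>; moving \<open>x\<close>, or \<open>- x\<close>, a little towards \<open>y\<close> leads into the wedge.\<close>

lemma proj_pt_in_closure_wedge:
  assumes indep: "\<bar>a \<bullet> b\<bar> \<noteq> norm a * norm b"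
    and x: "x \<noteq> 0" "0 \<le> (a \<bullet> x) * (b \<bullet> x)"
  shows "proj_pt x \<in> closure (wedge a b)"
proof -
  have nz: "a \<noteq> 0" "b \<noteq> 0"
    using indep by auto
  have cs: "- (a \<bullet> b) < norm a * norm b"
    using indep Cauchy_Schwarz_ineq2[of a b] by linarith
  define y where "y = norm b *\<^sub>R a + norm a *\<^sub>R b"
  have "a \<bullet> y = norm a * (norm a * norm b + a \<bullet> b)" "b \<bullet> y = norm b * (norm a * norm b + a \<bullet> b)"
    unfolding y_def
    by (simp_all add: inner_add_right dot_square_norm power2_eq_square inner_commute algebra_simps)
  then have y: "0 < a \<bullet> y" "0 < b \<bullet> y"
    using nz cs by (simp_all add: zero_less_mult_iff)
  have *: "proj_pt z \<in> closure (wedge a b)" if z: "z \<noteq> 0" "0 \<le> a \<bullet> z" "0 \<le> b \<bullet> z" for z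
  proof (rule ccontr)
    assume "proj_pt z \<notin> closure (wedge a b)"
    define U where "U = {w. w \<noteq> 0 \<and> proj_pt w \<in> - closure (wedge a b)}"
    have "open (- closure (wedge a b))"
      by (simp add: open_Compl)
    then have "open U"
      unfolding U_def open_rproj_def .
    moreover have "z \<in> U"
      unfolding U_def using z(1) \<open>proj_pt z \<notin> _\<close> by simp
    moreover have "(\<lambda>j. z + inverse (real (Suc j)) *\<^sub>R y) \<longlonglongrightarrow> z + 0 *\<^sub>R y"
      by (intro tendsto_intros LIMSEQ_inverse_real_of_nat)
    ultimately have "\<forall>\<^sub>F j in sequentially. z + inverse (real (Suc j)) *\<^sub>R y \<in> U"
      by (intro topological_tendstoD) auto
    then obtain j where j: "z + inverse (real (Suc j)) *\<^sub>R y \<in> U"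
      using eventually_happens by fastforce
    have "0 < inverse (real (Suc j))" by simp
    then have "proj_pt (z + inverse (real (Suc j)) *\<^sub>R y) \<in> wedge a b"
      unfolding wedge_def using y z
      by (intro imageI) (auto simp: inner_add_right intro!: add_nonneg_pos mult_pos_pos)
    then show False
      using j closure_subset[of "wedge a b"] unfolding U_def by auto
  qed
  from x(2) consider "0 \<le> a \<bullet> x" "0 \<le> b \<bullet> x" | "0 \<le> a \<bullet> - x" "0 \<le> b \<bullet> - x"
    by (auto simp: zero_le_mult_iff)
  then show ?thesis
    using *[of x] *[of "- x"] x(1) by cases (simp_all add: proj_pt_minus)
qed

text \<open>The interface between the topological parts and sign counts. For distinct hyperplanes a
  component of the complement contains a point of one of the two wedges, hence that connected wedge,
  and only the inclusion of its closure matters. For equal hyperplanes \<open>a\<close> and \<open>b\<close> are parallel, and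
  with \<open>t\<close> making \<open>t b\<close> a negative multiple of \<open>a\<close> the condition describes the
  hyperplane itself, which is contained in either of the two conventional parts.\<close>

lemma parts_contain_closed_wedge:
  fixes a b :: "'a::euclidean_space"
  assumes nz: "a \<noteq> 0" "b \<noteq> 0" and P: "P \<in> parts (proj_of ({a}\<^sup>\<bottom>)) (proj_of ({b}\<^sup>\<bottom>))"
  shows "\<exists>t. \<forall>x. x \<noteq> 0 \<longrightarrow> 0 \<le> (a \<bullet> x) * ((t *\<^sub>R b) \<bullet> x) \<longrightarrow> proj_pt x \<in> P"
proof -
  have mem: "proj_pt x \<in> proj_of ({c}\<^sup>\<bottom>) \<longleftrightarrow> c \<bullet> x = 0" if "x \<noteq> 0" for c x :: 'a
    using proj_pt_in_proj_of[OF subspace_orthogonal_comp that, of "{c}"]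
    by (simp add: orthogonal_comp_def orthogonal_def)
  have parallel: "\<exists>c. c \<noteq> 0 \<and> b = c *\<^sub>R a" if eq: "\<bar>a \<bullet> b\<bar> = norm a * norm b"
  proof -
    have "norm a *\<^sub>R b = norm b *\<^sub>R a \<or> norm a *\<^sub>R b = (- norm b) *\<^sub>R a"
      using eq unfolding norm_cauchy_schwarz_abs_eq .
    then have "b = (norm b / norm a) *\<^sub>R a \<or> b = (- norm b / norm a) *\<^sub>R a"
      unfolding eq_vector_fraction_iff using nz by simp
    moreover have "norm b / norm a \<noteq> 0" "- norm b / norm a \<noteq> 0"
      using nz by simp_all
    ultimately show ?thesis by blast
  qed
  show ?thesis
  proof (cases "proj_of ({a}\<^sup>\<bottom>) = proj_of ({b}\<^sup>\<bottom>)")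
    case True
    then have "P = proj_of ({a}\<^sup>\<bottom>) \<or> P = UNIV"
      using P by (auto simp: parts_def)
    have "{a}\<^sup>\<bottom> = {b}\<^sup>\<bottom>"
      using True proj_of_subset_iff[OF subspace_orthogonal_comp subspace_orthogonal_comp] by (metis order_antisym order_refl)
    then have "{a}\<^sup>\<bottom>\<^sup>\<bottom> = {b}\<^sup>\<bottom>\<^sup>\<bottom>" by simp
    moreover have "{a}\<^sup>\<bottom> = (span {a})\<^sup>\<bottom>" "{b}\<^sup>\<bottom> = (span {b})\<^sup>\<bottom>" 
      by (auto simp: orthogonal_comp_def orthogonal_def span_singleton)
    ultimately have "span {a} = span {b}"
      by (simp add: orthogonal_comp_self)
    then obtain c where c: "a = c *\<^sub>R b"
      using span_base[of a "{a}"] by (auto simp: span_singleton)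
    have "(a \<bullet> x) * ((- c *\<^sub>R b) \<bullet> x) = - (a \<bullet> x)\<^sup>2" for x
      by (simp add: c power2_eq_square)
    then show ?thesis
      using \<open>P = _ \<or> _\<close> mem by (intro exI[of _ "- c"]) auto
  next
    case False
    then obtain C where C: "C \<in> components (UNIV - (proj_of ({a}\<^sup>\<bottom>) \<union> proj_of ({b}\<^sup>\<bottom>)))" "P = closure C"
      using P by (auto simp: parts_def)
    then obtain p where p: "p \<in> C"
      using in_components_nonempty by blast
    obtain x where x: "x \<noteq> 0" "p = proj_pt x"
      by (rule proj_pt_cases)
    have "p \<notin> proj_of ({a}\<^sup>\<bottom>)" "p \<notin> proj_of ({b}\<^sup>\<bottom>)"
      using p in_components_subset[OF C(1)] by auto
    then have abx: "a \<bullet> x \<noteq> 0" "b \<bullet> x \<noteq> 0"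
      using mem x by auto
    define t where "t = sgn ((a \<bullet> x) * (b \<bullet> x))"
    have t: "t \<noteq> 0" "\<bar>t\<bar> = 1"
      unfolding t_def using abx by (auto simp: abs_sgn_eq sgn_zero_iff)
    have pos: "0 < (a \<bullet> x) * ((t *\<^sub>R b) \<bullet> x)"
    proof -
      have "(a \<bullet> x) * ((t *\<^sub>R b) \<bullet> x) = \<bar>(a \<bullet> x) * (b \<bullet> x)\<bar>"
        unfolding t_def abs_sgn by (simp add: ac_simps)
      then show ?thesis using abx by simp
    qed
    have "wedge a (t *\<^sub>R b) \<subseteq> UNIV - (proj_of ({a}\<^sup>\<bottom>) \<union> proj_of ({b}\<^sup>\<bottom>))"
    proof (clarsimp simp: wedge_def)
      fix y assume "0 < a \<bullet> y" "0 < t * (b \<bullet> y)"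
      moreover from this have "y \<noteq> 0" by auto
      ultimately show "proj_pt y \<notin> proj_of ({a}\<^sup>\<bottom>) \<and> proj_pt y \<notin> proj_of ({b}\<^sup>\<bottom>)"
        using mem by auto
    qed
    moreover have "p \<in> wedge a (t *\<^sub>R b)"
    proof -
      from pos consider "0 < a \<bullet> x" "0 < (t *\<^sub>R b) \<bullet> x" | "0 < a \<bullet> - x" "0 < (t *\<^sub>R b) \<bullet> - x"
        unfolding zero_less_mult_iff inner_minus_right neg_0_less_iff_less by blast
      then show ?thesis
        unfolding wedge_def x(2) by cases (metis (mono_tags, lifting) imageI mem_Collect_eq proj_pt_minus)+
    qed
    ultimately have "wedge a (t *\<^sub>R b) \<subseteq> C"
      using components_maximal[OF C(1) connected_wedge] p by blast
    then have "closure (wedge a (t *\<^sub>R b)) \<subseteq> P"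
      unfolding C(2) by (rule closure_mono)
    moreover have "\<bar>a \<bullet> t *\<^sub>R b\<bar> \<noteq> norm a * norm (t *\<^sub>R b)"
    proof
      assume "\<bar>a \<bullet> t *\<^sub>R b\<bar> = norm a * norm (t *\<^sub>R b)"
      then have "\<bar>a \<bullet> b\<bar> = norm a * norm b"
        using t by (simp add: abs_mult)
      then obtain c where "c \<noteq> 0" "b = c *\<^sub>R a"
        using parallel by blast
      then have "{a}\<^sup>\<bottom> = {b}\<^sup>\<bottom>"
        by (auto simp: orthogonal_comp_def orthogonal_def)
      then show False using False by simp
    qed
    ultimately show ?thesis
      using proj_pt_in_closure_wedge[of a "t *\<^sub>R b"] by blast
  qed
qed

section \<open>Balanced projective subspaces\<close>

lemma mult_less_if_Suc_eq_ceiling_quotient: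
  fixes n q s :: nat
  assumes "Suc s = nat \<lceil>real n / real q\<rceil>" "0 < q"
  shows "s * q < n"
proof -
  have "\<lceil>real n / real q\<rceil> = int s + 1"
    using assms(1) by linarith
  then have "real s < real n / real q"
    by linarith
  then have "real (s * q) < real n"
    using assms(2) by (simp add: field_simps)
  then show ?thesis
    by (simp only: of_nat_less_iff)
qed

theorem theorem1p2:
  fixes d n r :: nat and v :: int
    and V X :: "(real ^ 'n) rproj set"
  assumes "CARD('n) = d + 1"
    and "proj_subspace v V"
    and "finite X" and "card X = n"
    and "r = nat \<lceil>real n / real_of_int ((int d - v) * (v + 1) + 1)\<rceil>"
  shows "(\<exists>W. proj_subspace (int d - v - 1) W \<and>
            (\<forall>H1 H2. proj_hyperplane H1 \<and> V \<subseteq> H1 \<and> proj_hyperplane H2 \<and> W \<subseteq> H2 \<longrightarrow>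
               (\<forall>P \<in> parts H1 H2. r \<le> card (X \<inter> P)))) \<and>
         (\<not> (\<exists>Y H. Y \<subseteq> X \<and> card Y = r \<and> proj_hyperplane H \<and> Y \<union> V \<subseteq> H) \<longrightarrow>
          (\<exists>W. proj_subspace (int d - v - 1) W \<and> W \<inter> V = {} \<and>
            (\<forall>H1 H2. proj_hyperplane H1 \<and> V \<subseteq> H1 \<and> proj_hyperplane H2 \<and> W \<subseteq> H2 \<longrightarrow>
               (\<forall>P \<in> parts H1 H2. r \<le> card (X \<inter> P)))))"
proof -
  obtain S where S: "subspace S" "int (dim S) = v + 1" "V = proj_of S"
    using assms(2) unfolding proj_subspace_def proj_of_def by blast
  have dimS: "dim S \<le> d + 1"
    using dim_subset_UNIV[of S] assms(1) by simp
  define D where "D = dim S * (CARD('n) - dim S)"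
  have "int D = int (dim S) * (int (d + 1) - int (dim S))"
    unfolding D_def assms(1) using dimS by (simp only: of_nat_mult of_nat_diff)
  then have "(int d - v) * (v + 1) + 1 = int (D + 1)"
    unfolding S(2) by (simp add: algebra_simps)
  then have "real_of_int ((int d - v) * (v + 1) + 1) = real (D + 1)"
    by (metis of_int_of_nat_eq)
  then have r: "r = nat \<lceil>real n / real (D + 1)\<rceil>"
    using assms(5) by (simp only:)
  define x where "x p = (SOME y. y \<noteq> 0 \<and> p = proj_pt y)" for p :: "(real ^ 'n) rproj"
  have x: "x p \<noteq> 0" "proj_pt (x p) = p" for p
  proof -
    have "\<exists>y. y \<noteq> 0 \<and> p = proj_pt y"
      using proj_pt_cases[of p] by blast
    from someI_ex[OF this] show "x p \<noteq> 0" "proj_pt (x p) = p"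
      unfolding x_def by simp_all
  qed
  obtain N where N: "subspace N" "dim N = dim S"
    and balanced: "\<And>\<beta> a. \<beta> \<in> N \<Longrightarrow> a \<in> S\<^sup>\<bottom> \<Longrightarrow> r \<le> card {p\<in>X. 0 \<le> (\<beta> \<bullet> x p) * (a \<bullet> x p)}"
  proof (cases r)
    case 0
    then show ?thesis using that[OF S(1)] by simp
  next
    case (Suc s)
    then have "s * (dim S * (CARD('n) - dim S) + 1) < card X"
      using r mult_less_if_Suc_eq_ceiling_quotient[of s n "D + 1"] assms(4) unfolding D_def by simp
    from balanced_subspace_exists[OF S(1) assms(3) this, of x] show ?thesis
      using that Suc by (auto simp: Suc_le_eq)
  qed
  define W where "W = proj_of (N\<^sup>\<bottom>)"
  have dim_comp: "dim (T\<^sup>\<bottom>) + dim T = d + 1" if "subspace T" for T :: "(real^'n) set"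
    using dim_subspace_orthogonal_to_vectors[OF that subspace_UNIV] assms(1)
    by (simp add: orthogonal_comp_def)
  have W: "proj_subspace (int d - v - 1) W"
    unfolding proj_subspace_def W_def proj_of_def
    using dim_comp[OF N(1)] N(2) S(2) subspace_orthogonal_comp by (intro exI[of _ "N\<^sup>\<bottom>"]) auto
  have normal: "a \<in> T\<^sup>\<bottom>" if "subspace T" "proj_of T \<subseteq> proj_of ({a}\<^sup>\<bottom>)" for T and a :: "real^'n"
    using that proj_of_subset_iff[OF that(1) subspace_orthogonal_comp, of "{a}"]
    by (auto simp: orthogonal_comp_def orthogonal_commute)
  \<comment> \<open>Hyperplanes containing \<open>W\<close> are those with normal vector in \<open>N\<close>. Both signs of the product are
    covered by \<open>balanced\<close>, as \<open>N\<close> is closed under scaling by \<open>t\<close>.\<close>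
  have main: "r \<le> card (X \<inter> P)"
    if H: "proj_hyperplane H1" "V \<subseteq> H1" "proj_hyperplane H2" "W \<subseteq> H2" and P: "P \<in> parts H1 H2"
    for H1 H2 P
  proof -
    obtain a where a: "a \<noteq> 0" "H1 = proj_of ({a}\<^sup>\<bottom>)"
      using H(1) unfolding proj_hyperplane_iff by blast
    obtain b where b: "b \<noteq> 0" "H2 = proj_of ({b}\<^sup>\<bottom>)"
      using H(3) unfolding proj_hyperplane_iff by blast
    have aS: "a \<in> S\<^sup>\<bottom>"
      using normal[OF S(1)] H(2) S(3) a(2) by simp
    have "b \<in> N\<^sup>\<bottom>\<^sup>\<bottom>"
      using normal[OF subspace_orthogonal_comp] H(4) W_def b(2) by simp
    then have bN: "b \<in> N"
      by (simp add: orthogonal_comp_self[OF N(1)])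
    obtain t where t: "\<And>y. y \<noteq> 0 \<Longrightarrow> 0 \<le> (a \<bullet> y) * ((t *\<^sub>R b) \<bullet> y) \<Longrightarrow> proj_pt y \<in> P"
      using parts_contain_closed_wedge[OF a(1) b(1)] P a(2) b(2) by blast
    have "r \<le> card {p\<in>X. 0 \<le> ((t *\<^sub>R b) \<bullet> x p) * (a \<bullet> x p)}"
      by (rule balanced[OF subspace_scale[OF N(1) bN] aS])
    also have "\<dots> \<le> card (X \<inter> P)"
    proof (rule card_mono)
      show "{p\<in>X. 0 \<le> ((t *\<^sub>R b) \<bullet> x p) * (a \<bullet> x p)} \<subseteq> X \<inter> P"
        using t[OF x(1)] x(2) by (auto simp: mult.commute)
    qed (use assms(3) in simp)
    finally show ?thesis .
  qed
  \<comment> \<open>If \<open>V\<close> and \<open>W\<close> meet, they do not span the space and lie in a common hyperplane \<open>\<beta>\<^sup>\<bottom>\<close>. Balance for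
    the pair \<open>\<beta>\<close>, \<open>- \<beta>\<close> then puts \<open>r\<close> points into this hyperplane.\<close>
  have disjoint: "W \<inter> V = {}"
    if gp: "\<not> (\<exists>Y H. Y \<subseteq> X \<and> card Y = r \<and> proj_hyperplane H \<and> Y \<union> V \<subseteq> H)"
  proof (rule ccontr)
    assume "W \<inter> V \<noteq> {}"
    then obtain p where p: "p \<in> W" "p \<in> V" by blast
    obtain w where w: "w \<noteq> 0" "p = proj_pt w"
      by (rule proj_pt_cases)
    have wN: "w \<in> N\<^sup>\<bottom>" and wS: "w \<in> S"
      using p w proj_pt_in_proj_of[OF subspace_orthogonal_comp w(1)] proj_pt_in_proj_of[OF S(1) w(1)]
      unfolding W_def S(3) by auto
    have "\<not> N \<inter> S\<^sup>\<bottom> \<subseteq> {0}"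
    proof
      assume "N \<inter> S\<^sup>\<bottom> \<subseteq> {0}"
      then have dim0: "dim (N \<inter> S\<^sup>\<bottom>) = 0"
        by simp
      have "dim {y + z |y z. y \<in> N \<and> z \<in> S\<^sup>\<bottom>} = DIM(real^'n)"
        using dim_sums_Int[OF N(1) subspace_orthogonal_comp[of S]] dim_comp[OF S(1)] N(2) assms(1)
        unfolding dim0 by simp
      then have "span {y + z |y z. y \<in> N \<and> z \<in> S\<^sup>\<bottom>} = UNIV"
        by (simp only: dim_eq_full)
      moreover have "span {y + z |y z. y \<in> N \<and> z \<in> S\<^sup>\<bottom>} = {y + z |y z. y \<in> N \<and> z \<in> S\<^sup>\<bottom>}"
        unfolding span_eq_iff by (rule subspace_sums[OF N(1) subspace_orthogonal_comp])
      ultimately obtain y z where "w = y + z" "y \<in> N" "z \<in> S\<^sup>\<bottom>"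
        by blast
      then have "w \<bullet> w = 0"
        using wN wS by (auto simp: orthogonal_comp_def orthogonal_def inner_add_right inner_commute)
      then show False using w(1) by simp
    qed
    then obtain \<beta> where \<beta>: "\<beta> \<noteq> 0" "\<beta> \<in> N" "\<beta> \<in> S\<^sup>\<bottom>"
      by blast
    have "r \<le> card {q\<in>X. 0 \<le> (\<beta> \<bullet> x q) * ((- \<beta>) \<bullet> x q)}"
      by (rule balanced[OF \<beta>(2) subspace_neg[OF subspace_orthogonal_comp \<beta>(3)]])
    also have "{q\<in>X. 0 \<le> (\<beta> \<bullet> x q) * ((- \<beta>) \<bullet> x q)} = {q\<in>X. \<beta> \<bullet> x q = 0}"
      by (auto simp: mult_le_0_iff)
    finally obtain Y where Y: "Y \<subseteq> {q\<in>X. \<beta> \<bullet> x q = 0}" "card Y = r"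
      by (rule obtain_subset_with_card_n)
    have "q \<in> proj_of ({\<beta>}\<^sup>\<bottom>)" if "q \<in> Y" for q
      using proj_pt_in_proj_of[OF subspace_orthogonal_comp x(1)[of q], of "{\<beta>}"] that Y(1) x(2)[of q]
      by (auto simp: orthogonal_comp_def orthogonal_def)
    moreover have "V \<subseteq> proj_of ({\<beta>}\<^sup>\<bottom>)"
      unfolding S(3) proj_of_subset_iff[OF S(1) subspace_orthogonal_comp]
      using \<beta>(3) by (auto simp: orthogonal_comp_def orthogonal_commute)
    moreover have "proj_hyperplane (proj_of ({\<beta>}\<^sup>\<bottom>))"
      unfolding proj_hyperplane_iff using \<beta>(1) by blast
    ultimately show False
      using gp Y by blast
  qed
  show ?thesis
    using W main disjoint by blast
qed

end
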